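(* Let $a>0$, $\alpha\in\mathbb{R}$, and let $\psi\ge 0$ be a distributional solution to $$-\psi''\ \ge\ \alpha\,s^{-2}\psi\qquad\text{in }\mathcal{D}'(I_a),\qquad I_a=(a,\infty).$$ Assume that there exists $\gamma\le 1$ such that $$\psi\in L^2(I_a;s^{-2\gamma}\,ds),\qquad \alpha\ge\frac14-(1-\gamma)^2.$$ Then $\psi=0$ almost everywhere in $I_a$.
   Context: A distributional solution is a function $\psi\in L^1_{\rm loc}(I_a)$ such that $-\int_a^\infty\psi\varphi''\,ds\ge\alpha\int_a^\infty s^{-2}\psi\varphi\,ds$ for every non-negative $\varphi\in C^\infty_c(I_a)$. $L^2(I_a;s^{-2\gamma}\,ds)$ is the space of measurable $\psi$ on $I_a$ with $\int_a^\infty s^{-2\gamma}|\psi|^2\,ds<\infty$. *)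

theory Defs
  imports "HOL-Analysis.Analysis"
begin

definition smooth :: "(real \<Rightarrow> real) \<Rightarrow> bool" where
  "smooth f \<longleftrightarrow> (\<forall>n x. (deriv ^^ n) f differentiable at x)"

text \<open>
  An element of \<open>C\<^sub>c\<^sup>\<infinity>(\<Omega>)\<close> is represented by its extension by zero to the whole line;
  for open \<open>\<Omega>\<close> these are exactly the smooth functions on the line whose support is compact
  and contained in \<open>\<Omega>\<close>.
\<close>

definition test_functions :: "real set \<Rightarrow> (real \<Rightarrow> real) set" where
  "test_functions \<Omega> =
     {\<phi>. smooth \<phi> \<and> compact (closure {x. \<phi> x \<noteq> 0}) \<and> closure {x. \<phi> x \<noteq> 0} \<subseteq> \<Omega>}"

definition L1_loc :: "real set \<Rightarrow> (real \<Rightarrow> real) set" where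
  "L1_loc \<Omega> = {\<psi>. \<forall>K. compact K \<and> K \<subseteq> \<Omega> \<longrightarrow> \<psi> absolutely_integrable_on K}"

definition distributional_solution :: "real \<Rightarrow> real \<Rightarrow> (real \<Rightarrow> real) \<Rightarrow> bool" where
  "distributional_solution a \<alpha> \<psi> \<longleftrightarrow>
     \<psi> \<in> L1_loc {a<..} \<and>
     (\<forall>\<phi> \<in> test_functions {a<..}. (\<forall>s. \<phi> s \<ge> 0) \<longrightarrow>
        - (LINT s:{a<..}|lebesgue. \<psi> s * (deriv ^^ 2) \<phi> s)
          \<ge> \<alpha> * (LINT s:{a<..}|lebesgue. s powr (-2) * \<psi> s * \<phi> s))"

definition weighted_L2 :: "real \<Rightarrow> real \<Rightarrow> (real \<Rightarrow> real) set" where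
  "weighted_L2 a \<gamma> =
     {\<psi>. set_borel_measurable lebesgue {a<..} \<psi> \<and>
         (\<integral>\<^sup>+s\<in>{a<..}. ennreal (s powr (-2 * \<gamma>) * \<bar>\<psi> s\<bar>\<^sup>2) \<partial>lebesgue) < \<infinity>}"

end

theory Submission
  imports Defs "HOL-Real_Asymp.Real_Asymp"
begin

text \<open>
  Put \<open>\<beta> = 1 - \<gamma> \<ge> 0\<close> and let \<open>T' = s\<^bsup>2\<beta>-1\<^esup>\<close>, \<open>T a = 0\<close>. For
  \<open>\<phi> s = s\<^bsup>1/2-\<beta>\<^esup> H (T s)\<close> one has \<open>\<phi>'' + (1/4 - \<beta>\<^sup>2) s\<^bsup>-2\<^esup> \<phi> = s\<^bsup>3\<beta>-3/2\<^esup> H'' (T s)\<close>, so that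
  in the variable \<open>t = T s\<close> the inequality says that \<open>u = s\<^bsup>\<beta>-1/2\<^esup> \<psi>\<close> is concave; being
  non-negative on a half-line, \<open>u\<close> is non-decreasing, which is incompatible with
  \<open>\<integral> s\<^bsup>-2\<gamma>\<^esup> \<psi>\<^sup>2 < \<infinity>\<close> unless \<open>\<psi> = 0\<close>. This is carried out by a single family of test functions:
  \<open>H\<close> is a convex function, flat up to \<open>\<tau>\<close> and linearly growing, times a cutoff living on
  \<open>L \<le> t \<le> 2L\<close>. The cutoff error is \<open>O(1/L)\<close> pointwise, and \<open>\<psi> s\<^bsup>3\<beta>-3/2\<^esup>\<close> is the product of
  \<open>s\<^bsup>-\<gamma>\<^esup> \<psi>\<close> and \<open>s\<^bsup>2\<beta>-1/2\<^esup>\<close>, the latter having \<open>L\<^sup>2\<close> norm \<open>O(L)\<close> there. By the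
  weighted AM-GM inequality (weight \<open>K\<close>) the total error is at most \<open>K\<close> times the tail of a
  convergent integral plus \<open>O(1/K)\<close>; let first \<open>L \<rightarrow> \<infinity>\<close> and then \<open>K \<rightarrow> \<infinity>\<close>.
\<close>

section \<open>Smooth functions\<close>

lemma smooth_differentiable: "smooth f \<Longrightarrow> f differentiable at x"
  unfolding smooth_def by (metis funpow_0)

lemma smooth_has_deriv: "smooth f \<Longrightarrow> (f has_real_derivative deriv f x) (at x)"
  using smooth_differentiable DERIV_deriv_iff_real_differentiable by blast

lemma smooth_deriv: "smooth f \<Longrightarrow> smooth (deriv f)"
  unfolding smooth_def by (metis funpow_Suc_right comp_apply)

lemma smooth_continuous_on: "smooth f \<Longrightarrow> continuous_on A f"
  by (meson DERIV_continuous_on DERIV_subset smooth_has_deriv subset_UNIV)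

lemma deriv_eqI: "(\<And>x. (f has_real_derivative f' x) (at x)) \<Longrightarrow> deriv f = f'"
  by (rule ext) (rule DERIV_imp_deriv)

inductive_set fspan :: "(real \<Rightarrow> real) set \<Rightarrow> (real \<Rightarrow> real) set" for B where
  base: "f \<in> B \<Longrightarrow> f \<in> fspan B"
| add: "f \<in> fspan B \<Longrightarrow> g \<in> fspan B \<Longrightarrow> (\<lambda>x. f x + g x) \<in> fspan B"
| scale: "f \<in> fspan B \<Longrightarrow> (\<lambda>x. c * f x) \<in> fspan B"

text \<open>Smoothness by coinduction up to linear span: no formula for the higher derivatives is needed.\<close>

lemma smooth_fspan:
  assumes B: "\<And>f. f \<in> B \<Longrightarrow> \<exists>f'\<in>fspan B. \<forall>x. (f has_real_derivative f' x) (at x)"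
    and f: "f \<in> fspan B"
  shows "smooth f"
proof -
  have step: "\<exists>f'\<in>fspan B. \<forall>x. (f has_real_derivative f' x) (at x)" if "f \<in> fspan B" for f
    using that
  proof induction
    case (base f)
    then show ?case by (rule B)
  next
    case (add f g)
    then obtain f' g' where "f' \<in> fspan B" "\<forall>x. (f has_real_derivative f' x) (at x)"
      "g' \<in> fspan B" "\<forall>x. (g has_real_derivative g' x) (at x)" by blast
    then show ?case
      by (intro bexI[of _ "\<lambda>x. f' x + g' x"]) (auto intro: DERIV_add fspan.add)
  next
    case (scale f c)
    then obtain f' where "f' \<in> fspan B" "\<forall>x. (f has_real_derivative f' x) (at x)" by blast
    then show ?case
      by (intro bexI[of _ "\<lambda>x. c * f' x"]) (auto intro: DERIV_cmult fspan.scale)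
  qed
  have "(deriv ^^ n) f \<in> fspan B" for n
  proof (induction n)
    case (Suc n)
    then obtain g where g: "g \<in> fspan B" "\<And>x. ((deriv ^^ n) f has_real_derivative g x) (at x)"
      using step by metis
    from deriv_eqI[OF g(2)] g(1) show ?case by simp
  qed (simp add: f)
  then have "\<exists>g. \<forall>x. ((deriv ^^ n) f has_real_derivative g x) (at x)" for n
    using step by metis
  then show ?thesis
    unfolding smooth_def real_differentiable_def by metis
qed

text \<open>By the Leibniz rule the derivative of a product is a sum of two products of smooth
  functions. The generating family must therefore contain all such products, not just the given
  one.\<close>

lemma smooth_mult:
  assumes "smooth f" "smooth g"
  shows "smooth (\<lambda>x. f x * g x)"
proof (rule smooth_fspan)
  let ?B = "{\<lambda>x. f x * g x |f g. smooth f \<and> smooth g}"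
  have B: "(\<lambda>x. f x * g x) \<in> fspan ?B" if "smooth f" "smooth g" for f g
    using that by (intro fspan.base CollectI exI[of _ f] exI[of _ g]) simp
  show "(\<lambda>x. f x * g x) \<in> fspan ?B" by (rule B[OF assms])
  fix k assume "k \<in> ?B"
  then obtain f g where k: "k = (\<lambda>x. f x * g x)" and s: "smooth f" "smooth g" by blast
  have "(\<lambda>x. deriv f x * g x + f x * deriv g x) \<in> fspan ?B" (is "?k' \<in> _")
    by (intro fspan.add B s smooth_deriv)
  moreover have "\<forall>x. (k has_real_derivative deriv f x * g x + f x * deriv g x) (at x)"
    unfolding k using s by (auto intro!: derivative_eq_intros smooth_has_deriv)
  ultimately show "\<exists>k'\<in>fspan ?B. \<forall>x. (k has_real_derivative k' x) (at x)"
    by - (rule bexI[of _ ?k'])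
qed

lemma smooth_affine: "smooth (\<lambda>x. c * x + d)"
proof (rule smooth_fspan)
  let ?B = "range (\<lambda>(c, d) x. c * x + d :: real)"
  have B: "(\<lambda>x. c * x + d) \<in> fspan ?B" for c d
    by (rule fspan.base, rule image_eqI[of _ _ "(c, d)"]) auto
  show "(\<lambda>x. c * x + d) \<in> fspan ?B" by (rule B)
  fix k assume "k \<in> ?B"
  then obtain c d where k: "k = (\<lambda>x. c * x + d)" by auto
  \<comment> \<open>The constant derivative is written as an affine function so that it is again a
    generator.\<close>
  have "(\<lambda>x. 0 * x + c) \<in> fspan ?B" (is "?k' \<in> _") by (rule B)
  moreover have "\<forall>x. (k has_real_derivative 0 * x + c) (at x)"
    unfolding k by (auto intro!: derivative_eq_intros)
  ultimately show "\<exists>k'\<in>fspan ?B. \<forall>x. (k has_real_derivative k' x) (at x)"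
    by - (rule bexI[of _ ?k'])
qed

text \<open>With all smooth functions as generators the hypothesis of \<open>smooth_fspan\<close> is
  immediate, and its conclusion says that linear combinations of smooth functions are
  smooth.\<close>

lemma smooth_affine_comb:
  assumes "smooth f"
  shows "smooth (\<lambda>x. c * f x + d)"
proof (rule smooth_fspan)
  let ?B = "{f. smooth f}"
  have "(\<lambda>x. c * f x) \<in> fspan ?B" "(\<lambda>x. 0 * x + d) \<in> fspan ?B"
    using assms smooth_affine by (blast intro: fspan.base fspan.scale)+
  from fspan.add[OF this] show "(\<lambda>x. c * f x + d) \<in> fspan ?B" by simp
  fix k assume "k \<in> ?B"
  then show "\<exists>k'\<in>fspan ?B. \<forall>x. (k has_real_derivative k' x) (at x)"
    using smooth_deriv smooth_has_deriv by (blast intro: fspan.base)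
qed

text \<open>The chain rule produces the factor \<open>deriv k\<close>, so compositions alone are not
  closed under differentiation. Allowing an arbitrary smooth factor in front of f(k x) repairs this;
  the factor 1 recovers the composition.\<close>

lemma smooth_compose:
  assumes "smooth f" and k: "smooth k"
  shows "smooth (\<lambda>x. f (k x))"
proof (rule smooth_fspan)
  let ?B = "{\<lambda>x. g x * f (k x) |f g. smooth f \<and> smooth g}"
  have B: "(\<lambda>x. g x * f (k x)) \<in> fspan ?B" if "smooth f" "smooth g" for f g
    using that by (intro fspan.base CollectI exI[of _ f] exI[of _ g]) simp
  have "(\<lambda>x. (0 * x + 1) * f (k x)) \<in> fspan ?B"
    by (intro B assms smooth_affine)
  then show "(\<lambda>x. f (k x)) \<in> fspan ?B" by simp
  fix u assume "u \<in> ?B"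
  then obtain f g where u: "u = (\<lambda>x. g x * f (k x))" and s: "smooth f" "smooth g" by blast
  have "(\<lambda>x. deriv g x * f (k x) + (g x * deriv k x) * deriv f (k x)) \<in> fspan ?B"
    (is "?k' \<in> _")
    using s k by (intro fspan.add B smooth_mult smooth_deriv)
  moreover have "\<forall>x. (u has_real_derivative
      deriv g x * f (k x) + (g x * deriv k x) * deriv f (k x)) (at x)"
    unfolding u using s
    by (auto intro!: derivative_eq_intros smooth_has_deriv DERIV_chain2[OF smooth_has_deriv] k)
  ultimately show "\<exists>u'\<in>fspan ?B. \<forall>x. (u has_real_derivative u' x) (at x)"
    by - (rule bexI[of _ ?k'])
qed

section \<open>Flat functions and a cutoff\<close>

text \<open>The standard function exp(-1/x), extended by zero, with an extra power of x: over all
  real p these functions have derivatives in their own span.\<close>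

definition flat :: "real \<Rightarrow> real \<Rightarrow> real" where
  "flat p x = (if x \<le> 0 then 0 else x powr p * exp (- 1 / x))"

lemma flat_nonneg: "flat p x \<ge> 0"
  by (simp add: flat_def)

lemma flat_pos: "x > 0 \<Longrightarrow> flat p x > 0"
  by (simp add: flat_def)

lemma has_deriv_flat:
  "(flat p has_real_derivative p * flat (p - 1) x + flat (p - 2) x) (at x)"
proof -
  consider "x < 0" | "x = 0" | "x > 0" by linarith
  then show ?thesis
  proof cases
    case 1
    have "((\<lambda>x. 0) has_real_derivative 0) (at x)" by simp
    then have "(flat p has_real_derivative 0) (at x)"
      by (rule has_field_derivative_transform_within_open[of _ _ _ "{..<0}"])
        (use 1 in \<open>auto simp: flat_def\<close>)
    with 1 show ?thesis by (simp add: flat_def)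
  next
    case 2
    \<comment> \<open>This is the right-hand difference quotient at 0; the exponential beats every
      power, including negative ones.\<close>
    have "((\<lambda>x. x powr (p - 1) * exp (- 1 / x)) \<longlongrightarrow> 0) (at_right 0)"
      by real_asymp
    then have r: "((\<lambda>y. (flat p y - flat p 0) / (y - 0)) \<longlongrightarrow> 0) (at_right 0)"
      by (rule Lim_transform_eventually)
        (auto simp: flat_def eventually_at_filter powr_diff)
    have l: "((\<lambda>y. (flat p y - flat p 0) / (y - 0)) \<longlongrightarrow> 0) (at_left 0)"
      by (rule tendsto_eventually) (auto simp: flat_def eventually_at_filter)
    from l r have "((\<lambda>y. (flat p y - flat p 0) / (y - 0)) \<longlongrightarrow> 0) (at 0)"
      by (simp add: filterlim_split_at)
    with 2 show ?thesis by (simp add: has_field_derivative_iff flat_def)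
  next
    case 3
    have "((\<lambda>x. x powr p * exp (- 1 / x)) has_real_derivative
       p * x powr (p - 1) * exp (- 1 / x) + x powr p * (exp (- 1 / x) * (1 / x\<^sup>2))) (at x)"
      using 3 by (auto intro!: derivative_eq_intros simp: power2_eq_square)
    then have "(flat p has_real_derivative
       p * x powr (p - 1) * exp (- 1 / x) + x powr p * (exp (- 1 / x) * (1 / x\<^sup>2))) (at x)"
      by (rule has_field_derivative_transform_within_open[of _ _ _ "{0<..}"])
        (use 3 in \<open>auto simp: flat_def\<close>)
    with 3 show ?thesis by (simp add: flat_def powr_diff mult.assoc)
  qed
qed

lemma smooth_flat: "smooth (flat p)"
proof (rule smooth_fspan)
  let ?B = "range flat"
  show "flat p \<in> fspan ?B" by (blast intro: fspan.base)
  fix k assume "k \<in> ?B"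
  then obtain p where k: "k = flat p" by blast
  have "(\<lambda>x. p * flat (p - 1) x + flat (p - 2) x) \<in> fspan ?B" (is "?k' \<in> _")
    by (intro fspan.add fspan.scale fspan.base) auto
  then show "\<exists>k'\<in>fspan ?B. \<forall>x. (k has_real_derivative k' x) (at x)"
    using has_deriv_flat k by (intro bexI[of _ ?k']) auto
qed

lemma deriv_flat_1: "deriv (flat 1) = (\<lambda>x. flat 0 x + flat (-1) x)"
  using has_deriv_flat[of 1] by (intro deriv_eqI) simp

text \<open>For p = 1 the two \<open>flat (-2)\<close> contributions cancel. Hence
  \<open>flat 1\<close> is convex, with second derivative positive exactly for x > 0.\<close>

lemma deriv2_flat_1: "deriv (deriv (flat 1)) = flat (-3)"
proof -
  have "((\<lambda>x. flat 0 x + flat (-1) x) has_real_derivative flat (-3) x) (at x)" for x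
    using DERIV_add[OF has_deriv_flat[of 0 x] has_deriv_flat[of "-1" x]] by simp
  then show ?thesis unfolding deriv_flat_1 by (rule deriv_eqI)
qed

lemma flat_1_le: "x \<ge> 0 \<Longrightarrow> flat 1 x \<le> x"
  by (auto simp: flat_def)

text \<open>For x > 0 the derivative is (1 + 1/x) exp(-1/x), and 1 + y \<le> exp y with y = 1/x
  bounds it by 1.\<close>

lemma deriv_flat_1_bounds: "deriv (flat 1) x \<in> {0..1}"
proof (cases "x \<le> 0")
  case False
  have "(1 + 1 / x) * exp (- 1 / x) \<le> exp (1 / x) * exp (- 1 / x)"
    using exp_ge_add_one_self[of "1 / x"] by (intro mult_right_mono) auto
  then have "(1 + 1 / x) * exp (- 1 / x) \<le> 1" by (simp flip: exp_add)
  with False show ?thesis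
    by (simp add: deriv_flat_1 flat_def powr_minus field_simps)
qed (simp add: deriv_flat_1 flat_def)

text \<open>The constant exp(-1) is the value of \<open>flat 0\<close> at 1, so the outer argument
  is at most 0 once t \<ge> 2. For t \<le> 1 it equals exp(-1), and the plateau value is left
  unnormalised; this is the factor \<open>cutoff 1\<close> in the later estimates.\<close>

definition cutoff :: "real \<Rightarrow> real" where
  "cutoff t = flat 0 (exp (-1) - flat 0 (t - 1))"

lemma smooth_cutoff: "smooth cutoff"
proof -
  have "smooth (\<lambda>t. flat 0 (1 * t + (-1)))"
    by (rule smooth_compose[OF smooth_flat smooth_affine])
  from smooth_compose[OF smooth_flat smooth_affine_comb[OF this]]
  have "smooth (\<lambda>t. flat 0 ((-1) * flat 0 (1 * t + (-1)) + exp (-1)))" .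
  then show ?thesis by (simp add: cutoff_def[abs_def] fun_eq_iff)
qed

lemma cutoff_nonneg: "cutoff t \<ge> 0"
  by (simp add: cutoff_def flat_nonneg)

lemma cutoff_left: "t \<le> 1 \<Longrightarrow> cutoff t = cutoff 1"
  by (simp add: cutoff_def flat_def)

lemma cutoff_1_pos: "cutoff 1 > 0"
  by (simp add: cutoff_def flat_def)

lemma cutoff_right: "t \<ge> 2 \<Longrightarrow> cutoff t = 0"
  by (auto simp: cutoff_def flat_def)

lemma deriv_eq_0_of_const:
  fixes f :: "real \<Rightarrow> real"
  assumes "open S" "x \<in> S" "\<And>y. y \<in> S \<Longrightarrow> f y = c"
  shows "deriv f x = 0"
proof (rule DERIV_imp_deriv)
  have "((\<lambda>x. c) has_real_derivative 0) (at x)" by simp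
  then show "(f has_real_derivative 0) (at x)"
    by (rule has_field_derivative_transform_within_open) (use assms in auto)
qed

lemma deriv_eq_0_outside:
  fixes f :: "real \<Rightarrow> real"
  assumes "\<And>t. t \<notin> {p..q} \<Longrightarrow> f t = 0" "t \<notin> {p..q}"
  shows "deriv f t = 0"
proof (rule deriv_eq_0_of_const)
  show "open (- {p..q})" by (simp add: open_Compl)
qed (use assms in auto)

lemma deriv_cutoff_0:
  assumes "t \<notin> {1..2}"
  shows "deriv cutoff t = 0" "deriv (deriv cutoff) t = 0"
proof -
  have *: "deriv cutoff t = 0" if "t \<notin> {1..2}" for t
  proof (cases "t < 1")
    case True
    then show ?thesis
      by - (rule deriv_eq_0_of_const[OF open_lessThan, of _ 1 _ "cutoff 1"], simp, rule cutoff_left, simp)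
  next
    case False
    with that show ?thesis
      by - (rule deriv_eq_0_of_const[OF open_greaterThan, of _ 2 _ 0], simp_all add: cutoff_right)
  qed
  then show "deriv cutoff t = 0" using assms by blast
  show "deriv (deriv cutoff) t = 0"
    using * assms by (rule deriv_eq_0_outside)
qed

lemma cutoff_derivs_bounded:
  obtains D where "D > 0" "\<And>t. \<bar>deriv cutoff t\<bar> \<le> D" "\<And>t. \<bar>deriv (deriv cutoff) t\<bar> \<le> D"
proof -
  have *: "\<exists>D. \<forall>t. \<bar>f t\<bar> \<le> D"
    if f: "smooth f" "\<And>t. t \<notin> {1..2} \<Longrightarrow> f t = 0" for f :: "real \<Rightarrow> real"
  proof -
    have "bounded (f ` {1..2})"
      by (intro compact_imp_bounded compact_continuous_image smooth_continuous_on f) auto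
    then obtain D where "\<forall>t\<in>{1..2}. norm (f t) \<le> D"
      unfolding bounded_iff by auto
    then have "\<bar>f t\<bar> \<le> max D 0" for t
      using f(2)[of t] by (cases "t \<in> {1..2}") (simp_all add: le_max_iff_disj)
    then show ?thesis by (intro exI[of _ "max D 0"]) simp
  qed
  obtain D1 where D1: "\<forall>t. \<bar>deriv cutoff t\<bar> \<le> D1"
    using *[OF smooth_deriv[OF smooth_cutoff] deriv_cutoff_0(1)] ..
  obtain D2 where D2: "\<forall>t. \<bar>deriv (deriv cutoff) t\<bar> \<le> D2"
    using *[OF smooth_deriv[OF smooth_deriv[OF smooth_cutoff]] deriv_cutoff_0(2)] ..
  show ?thesis
    by (rule that[of "max 1 (max D1 D2)"]) (use D1 D2 in \<open>simp_all add: le_max_iff_disj\<close>)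
qed

section \<open>The truncated convex profile and its second derivative\<close>

definition profile :: "real \<Rightarrow> real \<Rightarrow> real \<Rightarrow> real" where
  "profile \<tau> L t = flat 1 (t - \<tau>) * cutoff (t / L)"

lemma smooth_profile: "smooth (profile \<tau> L)"
proof -
  have "smooth (\<lambda>t. flat 1 (1 * t + (-\<tau>)) * cutoff ((1 / L) * t + 0))"
    by (intro smooth_mult smooth_compose[OF smooth_flat smooth_affine]
        smooth_compose[OF smooth_cutoff smooth_affine])
  then show ?thesis by (simp add: profile_def[abs_def])
qed

lemma profile_nonneg: "profile \<tau> L t \<ge> 0"
  by (simp add: profile_def flat_nonneg cutoff_nonneg)

lemma profile_outside: "L > 0 \<Longrightarrow> t \<notin> {\<tau>..2 * L} \<Longrightarrow> profile \<tau> L t = 0"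
  by (auto simp: profile_def flat_def not_le intro!: cutoff_right) (simp add: field_simps)

lemma deriv2_profile:
  "deriv (deriv (profile \<tau> L)) t =
     flat (-3) (t - \<tau>) * cutoff (t / L) + 2 * deriv (flat 1) (t - \<tau>) * (deriv cutoff (t / L) / L)
       + flat 1 (t - \<tau>) * (deriv (deriv cutoff) (t / L) / L\<^sup>2)"
proof -
  have shift: "((\<lambda>t. f (t - \<tau>)) has_real_derivative deriv f (t - \<tau>)) (at t)"
    if "smooth f" for f t
  proof -
    have "((\<lambda>t. t - \<tau>) has_real_derivative 1) (at t)" by (auto intro!: derivative_eq_intros)
    from DERIV_chain2[OF smooth_has_deriv[OF that] this] show ?thesis by simp
  qed
  have scale: "((\<lambda>t. f (t / L)) has_real_derivative deriv f (t / L) / L) (at t)"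
    if "smooth f" for f t
  proof -
    have "((\<lambda>t. t / L) has_real_derivative 1 / L) (at t)" by (intro DERIV_cdivide DERIV_ident)
    from DERIV_chain2[OF smooth_has_deriv[OF that] this] show ?thesis by simp
  qed
  note s = smooth_flat[of 1] smooth_cutoff
  have d1: "deriv (profile \<tau> L) = (\<lambda>t. deriv (flat 1) (t - \<tau>) * cutoff (t / L)
      + flat 1 (t - \<tau>) * (deriv cutoff (t / L) / L))"
    unfolding profile_def[abs_def]
    by (rule deriv_eqI)
      (use DERIV_mult[OF shift[OF s(1)] scale[OF s(2)]] in \<open>simp add: algebra_simps\<close>)
  have "((\<lambda>t. deriv (flat 1) (t - \<tau>) * cutoff (t / L)
      + flat 1 (t - \<tau>) * (deriv cutoff (t / L) / L)) has_real_derivative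
      (deriv (deriv (flat 1)) (t - \<tau>) * cutoff (t / L)
        + deriv cutoff (t / L) / L * deriv (flat 1) (t - \<tau>))
      + (deriv (flat 1) (t - \<tau>) * (deriv cutoff (t / L) / L)
        + deriv (deriv cutoff) (t / L) / L / L * flat 1 (t - \<tau>))) (at t)"
    by (intro DERIV_add DERIV_mult DERIV_cdivide shift scale s smooth_deriv)
  then show ?thesis
    unfolding d1 deriv2_flat_1[symmetric]
    by (intro DERIV_imp_deriv) (simp add: algebra_simps power2_eq_square)
qed

text \<open>The terms in which the cutoff is differentiated live on [L, 2L], where
  \<open>flat 1 (t - \<tau>)\<close> is at most 2L and its derivative at most 1. Each is then at
  most 2D/L in absolute value.\<close>

lemma deriv2_profile_ge:
  assumes D: "\<And>t. \<bar>deriv cutoff t\<bar> \<le> D" "\<And>t. \<bar>deriv (deriv cutoff) t\<bar> \<le> D"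
    and "L > 0" "\<tau> \<ge> 0"
  shows "deriv (deriv (profile \<tau> L)) t \<ge>
    flat (-3) (t - \<tau>) * cutoff (t / L) - (if t \<in> {L..2 * L} then 4 * D / L else 0)"
proof (cases "t \<in> {L..2 * L}")
  case False
  then have "t / L \<notin> {1..2}" using \<open>L > 0\<close> by (auto simp: field_simps)
  with False show ?thesis by (auto simp: deriv2_profile deriv_cutoff_0)
next
  case True
  have "0 \<le> D" using D(1)[of 0] by linarith
  have "\<bar>2 * deriv (flat 1) (t - \<tau>) * (deriv cutoff (t / L) / L)\<bar> \<le> (2 * 1) * (D / L)"
    unfolding abs_mult[of "2 * _"] using D(1)[of "t / L"] deriv_flat_1_bounds[of "t - \<tau>"] \<open>L > 0\<close>
    by (intro mult_mono) (auto intro!: divide_right_mono)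
  moreover have "flat 1 (t - \<tau>) \<le> 2 * L"
    using True \<open>\<tau> \<ge> 0\<close> \<open>L > 0\<close> flat_1_le[of "t - \<tau>"] by (cases "t \<ge> \<tau>") (auto simp: flat_def)
  then have "\<bar>flat 1 (t - \<tau>) * (deriv (deriv cutoff) (t / L) / L\<^sup>2)\<bar> \<le> (2 * L) * (D / L\<^sup>2)"
    unfolding abs_mult using D(2)[of "t / L"] \<open>L > 0\<close> flat_nonneg[of 1 "t - \<tau>"]
    by (intro mult_mono) (auto intro!: divide_right_mono)
  moreover have "(2 * L) * (D / L\<^sup>2) = 2 * (D / L)"
    using \<open>L > 0\<close> by (simp add: power2_eq_square)
  moreover have "4 * D / L = 4 * (D / L)" by simp
  ultimately show ?thesis
    unfolding deriv2_profile if_P[OF True] by linarith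
qed

section \<open>The change of variable\<close>

locale euler =
  fixes a \<beta> :: real
  assumes a_pos: "a > 0" and beta_nonneg: "\<beta> \<ge> 0"
begin

text \<open>The Euler equation u'' + (1/4 - \<beta>^2) s^(-2) u = 0 has the solution
  s^(1/2-\<beta>). Up to scaling and an additive constant, T is the quotient by it of a second,
  independent solution: s^(1/2+\<beta>), or s^(1/2) ln s when \<beta> = 0.\<close>

definition T :: "real \<Rightarrow> real" where
  "T s = (if \<beta> = 0 then ln (s / a) else (s powr (2 * \<beta>) - a powr (2 * \<beta>)) / (2 * \<beta>))"

lemma T_a: "T a = 0"
  using a_pos by (simp add: T_def)

text \<open>Both sides are 1 when \<beta> = 0, so the identity spares later arguments the case
  distinction.\<close>

lemma powr_T: "s > 0 \<Longrightarrow> s powr (2 * \<beta>) = 2 * \<beta> * T s + a powr (2 * \<beta>)"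
  using a_pos by (simp add: T_def)

lemma has_deriv_T:
  assumes "s > 0"
  shows "(T has_real_derivative s powr (2 * \<beta> - 1)) (at s)"
proof (cases "\<beta> = 0")
  case True
  have "((\<lambda>s. ln (s / a)) has_real_derivative 1 / s) (at s)"
    using assms a_pos by (auto intro!: derivative_eq_intros)
  moreover have "T = (\<lambda>s. ln (s / a))"
    unfolding T_def[abs_def] using True by simp
  ultimately show ?thesis
    using True assms by (simp add: powr_minus divide_inverse)
next
  case False
  have "((\<lambda>s. (s powr (2 * \<beta>) - a powr (2 * \<beta>)) / (2 * \<beta>)) has_real_derivative
      s powr (2 * \<beta> - 1)) (at s)"
    using assms False by (auto intro!: derivative_eq_intros)
  with False show ?thesis by (simp add: T_def[abs_def])
qed

lemma T_less:
  assumes "0 < s" "s < t"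
  shows "T s < T t"
proof (rule DERIV_pos_imp_increasing[OF \<open>s < t\<close>])
  fix x assume "s \<le> x"
  with \<open>0 < s\<close> have "x > 0" by simp
  then show "\<exists>y. DERIV T x :> y \<and> y > 0"
    by (intro exI[of _ "x powr (2 * \<beta> - 1)"] conjI has_deriv_T) simp_all
qed

lemma T_at_top: "filterlim T at_top at_top"
proof (cases "\<beta> = 0")
  case True
  have "filterlim (\<lambda>s. ln (s / a)) at_top at_top"
    using a_pos by real_asymp
  moreover have "T = (\<lambda>s. ln (s / a))"
    unfolding T_def[abs_def] using True by simp
  ultimately show ?thesis by simp
next
  case False
  with beta_nonneg have "\<beta> > 0" by simp
  then have "filterlim (\<lambda>s. (s powr (2 * \<beta>) - a powr (2 * \<beta>)) / (2 * \<beta>)) at_top at_top"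
    by real_asymp
  with False show ?thesis by (simp add: T_def[abs_def])
qed

text \<open>Test functions live on the whole line, hence the extension by zero. It is smooth when H
  is smooth and vanishes below T b for some b > a.\<close>

definition lift :: "real \<Rightarrow> (real \<Rightarrow> real) \<Rightarrow> real \<Rightarrow> real" where
  "lift r H s = (if s \<le> a then 0 else s powr r * H (T s))"

lemma powr_lift: "s powr r * lift q H s = lift (r + q) H s"
  using a_pos by (simp add: lift_def powr_add)

lemma has_deriv_lift:
  assumes "smooth H" "\<And>t. t < T b \<Longrightarrow> H t = 0" "a < b"
  shows "(lift r H has_real_derivative
    r * lift (r - 1) H s + lift (r + 2 * \<beta> - 1) (deriv H) s) (at s)"
proof (cases "s \<le> a")
  case True
  have "((\<lambda>s. 0) has_real_derivative 0) (at s)" by simp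
  then have "(lift r H has_real_derivative 0) (at s)"
  \<comment> \<open>The gap between a and b matters here: the function vanishes on all of s < b, an
    open neighbourhood of every point s \<le> a.\<close>
  proof (rule has_field_derivative_transform_within_open[of _ _ _ "{..<b}"])
    fix x assume "x \<in> {..<b}"
    then show "0 = lift r H x"
      using assms T_less[of x b] a_pos by (auto simp: lift_def)
  qed (use True assms in auto)
  with True show ?thesis by (simp add: lift_def)
next
  case False
  with a_pos have "s > 0" by simp
  then have "((\<lambda>s. s powr r * H (T s)) has_real_derivative
      r * s powr (r - 1) * H (T s) + s powr r * (deriv H (T s) * s powr (2 * \<beta> - 1))) (at s)"
    by (auto intro!: derivative_eq_intros DERIV_chain2[OF smooth_has_deriv[OF assms(1)]]
        has_deriv_T)
  then have "(lift r H has_real_derivative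
      r * s powr (r - 1) * H (T s) + s powr r * (deriv H (T s) * s powr (2 * \<beta> - 1))) (at s)"
    by (rule has_field_derivative_transform_within_open[of _ _ _ "{a<..}"])
      (use False in \<open>auto simp: lift_def\<close>)
  moreover have "s powr (r + 2 * \<beta> - 1) = s powr r * s powr (2 * \<beta> - 1)"
    by (simp flip: powr_add add: algebra_simps)
  ultimately show ?thesis
    using False by (simp add: lift_def mult_ac)
qed

lemma deriv_eq_0_below:
  assumes "\<And>t. t < T b \<Longrightarrow> H t = 0" "t < T b"
  shows "deriv H t = (0::real)"
  by (rule deriv_eq_0_of_const[OF open_lessThan, of _ "T b"]) (use assms in auto)

text \<open>Differentiation shifts the exponent and possibly replaces H by its derivative, which
  still vanishes below T b. So r and H both vary in the generating family while b stays
  fixed.\<close>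

lemma smooth_lift:
  assumes "smooth H" "\<And>t. t < T b \<Longrightarrow> H t = 0" "a < b"
  shows "smooth (lift r H)"
proof (rule smooth_fspan)
  let ?B = "{lift r H |r H. smooth H \<and> (\<forall>t<T b. H t = 0)}"
  have B: "lift r H \<in> fspan ?B" if "smooth H" "\<And>t. t < T b \<Longrightarrow> H t = 0" for r H
    using that by (intro fspan.base CollectI exI[of _ r] exI[of _ H]) simp
  show "lift r H \<in> fspan ?B" by (intro B assms)
  fix k assume "k \<in> ?B"
  then obtain r H where k: "k = lift r H" and H: "smooth H" "\<And>t. t < T b \<Longrightarrow> H t = 0" by auto
  have "lift (r - 1) H \<in> fspan ?B" "lift (r + 2 * \<beta> - 1) (deriv H) \<in> fspan ?B"
    using deriv_eq_0_below[of b H] H by (auto intro!: B smooth_deriv)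
  then have "(\<lambda>s. r * lift (r - 1) H s + lift (r + 2 * \<beta> - 1) (deriv H) s) \<in> fspan ?B"
    (is "?k' \<in> _")
    by (intro fspan.add fspan.scale)
  then show "\<exists>k'\<in>fspan ?B. \<forall>x. (k has_real_derivative k' x) (at x)"
    unfolding k using has_deriv_lift[OF H \<open>a < b\<close>, of r] by (intro bexI[of _ ?k']) auto
qed

text \<open>The first-order terms cancel because \<open>2 * (1/2 - \<beta>) + 2 * \<beta> - 1 = 0\<close>.\<close>

lemma deriv2_lift:
  assumes H: "smooth H" "\<And>t. t < T b \<Longrightarrow> H t = 0" "a < b"
  shows "(deriv ^^ 2) (lift (1/2 - \<beta>) H) s =
    (\<beta>\<^sup>2 - 1/4) * lift (- 3/2 - \<beta>) H s + lift (3 * \<beta> - 3/2) (deriv (deriv H)) s"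
proof -
  have H': "smooth (deriv H)" "\<And>t. t < T b \<Longrightarrow> deriv H t = 0"
    using H deriv_eq_0_below[of b H] by (auto intro: smooth_deriv)
  have 1: "deriv (lift (1/2 - \<beta>) H) =
      (\<lambda>s. (1/2 - \<beta>) * lift (- 1/2 - \<beta>) H s + lift (\<beta> - 1/2) (deriv H) s)"
    by (rule deriv_eqI) (use has_deriv_lift[OF H, of "1/2 - \<beta>"] in simp)
  have "((\<lambda>s. (1/2 - \<beta>) * lift (- 1/2 - \<beta>) H s + lift (\<beta> - 1/2) (deriv H) s) has_real_derivative
      (1/2 - \<beta>) * ((- 1/2 - \<beta>) * lift (- 1/2 - \<beta> - 1) H s
          + lift (- 1/2 - \<beta> + 2 * \<beta> - 1) (deriv H) s)
      + ((\<beta> - 1/2) * lift (\<beta> - 1/2 - 1) (deriv H) s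
          + lift (\<beta> - 1/2 + 2 * \<beta> - 1) (deriv (deriv H)) s)) (at s)"
    by (intro DERIV_add DERIV_cmult has_deriv_lift[OF H] has_deriv_lift[OF H' H(3)])
  moreover have "- 1/2 - \<beta> - 1 = - 3/2 - \<beta>" "- 1/2 - \<beta> + 2 * \<beta> - 1 = \<beta> - 3/2"
    "\<beta> - 1/2 - 1 = \<beta> - 3/2" "\<beta> - 1/2 + 2 * \<beta> - 1 = 3 * \<beta> - 3/2"
    by simp_all
  ultimately have "deriv (deriv (lift (1/2 - \<beta>) H)) s =
      (1/2 - \<beta>) * ((- 1/2 - \<beta>) * lift (- 3/2 - \<beta>) H s + lift (\<beta> - 3/2) (deriv H) s)
      + ((\<beta> - 1/2) * lift (\<beta> - 3/2) (deriv H) s + lift (3 * \<beta> - 3/2) (deriv (deriv H)) s)"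
    unfolding 1 by (intro DERIV_imp_deriv) simp
  also have "\<dots> = (\<beta>\<^sup>2 - 1/4) * lift (- 3/2 - \<beta>) H s + lift (3 * \<beta> - 3/2) (deriv (deriv H)) s"
    by (simp add: power2_eq_square field_simps)
  finally show ?thesis
    by (simp add: eval_nat_numeral)
qed

lemma lift_outside:
  assumes "\<And>t. t \<notin> {T b..T q} \<Longrightarrow> H t = 0" "a < b" "b < q" "s \<notin> {b..q}"
  shows "lift r H s = 0"
proof (cases "s \<le> a")
  case False
  then have "0 < s" using a_pos by simp
  then have "T s \<notin> {T b..T q}"
    using T_less[of s b] T_less[of q s] assms a_pos by (auto simp: not_le)
  with assms(1) show ?thesis by (simp add: lift_def)
qed (simp add: lift_def)

lemma lift_test_function:
  assumes H: "smooth H" "\<And>t. t \<notin> {T b..T q} \<Longrightarrow> H t = 0" "a < b" "b < q"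
  shows "lift r H \<in> test_functions {a<..}"
proof -
  have "{s. lift r H s \<noteq> 0} \<subseteq> {b..q}"
    using lift_outside[of b q H, OF H(2-4)] by blast
  then have *: "closure {s. lift r H s \<noteq> 0} \<subseteq> {b..q}"
    by (simp add: closure_minimal)
  moreover have "{b..q} \<subseteq> {a<..}" using \<open>a < b\<close> by auto
  moreover have "compact (closure {s. lift r H s \<noteq> 0})"
    using * compact_Icc closed_closure by (metis compact_Int_closed inf.absorb_iff2)
  moreover have "smooth (lift r H)"
    by (rule smooth_lift[OF H(1) _ H(3)]) (use H(2) in auto)
  ultimately show ?thesis
    by (auto simp: test_functions_def)
qed

section \<open>Testing the inequality\<close>

lemma continuous_on_T:
  assumes "A \<subseteq> {a<..}"
  shows "continuous_on A T"
proof (rule DERIV_continuous_on)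
  fix s assume "s \<in> A"
  with assms a_pos have "s > 0" by auto
  then show "(T has_real_derivative s powr (2 * \<beta> - 1)) (at s within A)"
    using has_deriv_T has_field_derivative_at_within by blast
qed

lemma continuous_on_weight:
  assumes "smooth K" "A \<subseteq> {a<..}"
  shows "continuous_on A (\<lambda>s. s powr e * K (T s))"
proof -
  have "continuous_on A (\<lambda>s. K (T s))"
    by (rule continuous_on_compose2[OF smooth_continuous_on[OF assms(1), of UNIV]
          continuous_on_T[OF assms(2)]]) simp
  moreover have "continuous_on A (\<lambda>s. s powr e)"
    using assms(2) a_pos by (intro continuous_intros) auto
  ultimately show ?thesis by (intro continuous_on_mult)
qed

lemma integrable_mult_continuous:
  assumes "\<psi> \<in> L1_loc {a<..}" "{b..q} \<subseteq> {a<..}" "continuous_on {b..q} k"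
  shows "set_integrable lebesgue {b..q} (\<lambda>s. \<psi> s * k s)"
proof -
  have "\<psi> absolutely_integrable_on {b..q}"
    using assms(1,2) by (auto simp: L1_loc_def)
  moreover have "k \<in> borel_measurable (lebesgue_on {b..q})"
    using assms(3) by (intro continuous_imp_measurable_on_sets_lebesgue) auto
  moreover have "bounded (k ` {b..q})"
    using assms(3) by (intro compact_imp_bounded compact_continuous_image) auto
  ultimately have "(\<lambda>s. k s * \<psi> s) absolutely_integrable_on {b..q}"
    by (intro absolutely_integrable_bounded_measurable_product_real) auto
  then show ?thesis by (simp add: mult.commute)
qed

lemma integrable_lift:
  assumes "\<psi> \<in> L1_loc {a<..}" and H: "smooth H" "\<And>t. t \<notin> {T b..T q} \<Longrightarrow> H t = 0" "a < b" "b < q"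
  shows "set_integrable lebesgue {a<..} (\<lambda>s. \<psi> s * lift r H s)"
proof -
  have sub: "{b..q} \<subseteq> {a<..}" using \<open>a < b\<close> by auto
  have "continuous_on {b..q} (lift r H)"
    by (rule continuous_on_eq[OF continuous_on_weight[OF H(1) sub, of r]])
      (use sub in \<open>auto simp: lift_def\<close>)
  from integrable_mult_continuous[OF assms(1) sub this]
  have "set_integrable lebesgue {b..q} (\<lambda>s. \<psi> s * lift r H s)" .
  moreover have "indicator {b..q} s *\<^sub>R (\<psi> s * lift r H s)
      = indicator {a<..} s *\<^sub>R (\<psi> s * lift r H s)" for s
  proof (cases "s \<in> {b..q}")
    case False
    then have "lift r H s = 0" using H(2-4) by (intro lift_outside) auto
    then show ?thesis by simp
  qed (use sub in auto)
  ultimately show ?thesis by (simp only: set_integrable_def)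
qed

text \<open>Testing with \<open>lift (1/2 - \<beta>) H\<close>, the potential term and the
  zeroth-order part of the second derivative are multiples of one integral, that of \<psi>
  s^(-3/2-\<beta>) H(T s). It is non-negative and enters the upper bound with factor 1/4 - \<beta>^2
  - \<alpha> \<le> 0, so only H'' survives.\<close>

lemma weak_inequality:
  assumes sol: "distributional_solution a \<alpha> \<psi>"
    and nonneg: "AE s\<in>{a<..} in lebesgue. \<psi> s \<ge> 0"
    and \<alpha>: "\<alpha> \<ge> 1/4 - \<beta>\<^sup>2"
    and H: "smooth H" "\<And>t. t \<notin> {T b..T q} \<Longrightarrow> H t = 0" "a < b" "b < q" "\<And>t. H t \<ge> 0"
  shows "(LINT s:{a<..}|lebesgue. \<psi> s * lift (3 * \<beta> - 3/2) (deriv (deriv H)) s) \<le> 0"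
proof -
  have L1: "\<psi> \<in> L1_loc {a<..}" using sol by (simp add: distributional_solution_def)
  have H': "deriv H t = 0" if "t \<notin> {T b..T q}" for t
    using H(2) that by (rule deriv_eq_0_outside)
  have H'': "deriv (deriv H) t = 0" if "t \<notin> {T b..T q}" for t
    using H' that by (rule deriv_eq_0_outside)
  have deriv2: "(deriv ^^ 2) (lift (1/2 - \<beta>) H) s =
      (\<beta>\<^sup>2 - 1/4) * lift (- 3/2 - \<beta>) H s + lift (3 * \<beta> - 3/2) (deriv (deriv H)) s" for s
    by (rule deriv2_lift[of H b]) (use H in auto)
  let ?r = "1/2 - \<beta>" and ?u = "\<lambda>s. \<psi> s * lift (- 3/2 - \<beta>) H s"
    and ?v = "\<lambda>s. \<psi> s * lift (3 * \<beta> - 3/2) (deriv (deriv H)) s"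
  have u: "set_integrable lebesgue {a<..} ?u"
    by (rule integrable_lift[OF L1 H(1-4)])
  have v: "set_integrable lebesgue {a<..} ?v"
    by (rule integrable_lift[OF L1 smooth_deriv[OF smooth_deriv[OF H(1)]] H'' H(3,4)])
  have "lift ?r H \<in> test_functions {a<..}" by (rule lift_test_function[OF H(1-4)])
  moreover have "\<forall>s. lift ?r H s \<ge> 0" using H(5) by (simp add: lift_def)
  ultimately have "\<alpha> * (LINT s:{a<..}|lebesgue. s powr (-2) * \<psi> s * lift ?r H s)
      \<le> - (LINT s:{a<..}|lebesgue. \<psi> s * (deriv ^^ 2) (lift ?r H) s)"
    using sol by (simp add: distributional_solution_def)
  also have "(\<lambda>s. s powr (-2) * \<psi> s * lift ?r H s) = ?u"
    using powr_lift[of _ "-2" ?r H] by (auto simp: algebra_simps)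
  also have "(\<lambda>s. \<psi> s * (deriv ^^ 2) (lift ?r H) s) = (\<lambda>s. (\<beta>\<^sup>2 - 1/4) * ?u s + ?v s)"
    unfolding deriv2 by (intro ext) (simp add: algebra_simps)
  also have "(LINT s:{a<..}|lebesgue. (\<beta>\<^sup>2 - 1/4) * ?u s + ?v s)
      = (\<beta>\<^sup>2 - 1/4) * (LINT s:{a<..}|lebesgue. ?u s) + (LINT s:{a<..}|lebesgue. ?v s)"
    using u v by (subst set_integral_add(2)) auto
  finally have *: "(LINT s:{a<..}|lebesgue. ?v s)
      \<le> (1/4 - \<beta>\<^sup>2 - \<alpha>) * (LINT s:{a<..}|lebesgue. ?u s)"
    by (simp add: algebra_simps)
  have "(LINT s:{a<..}|lebesgue. ?u s) \<ge> 0"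
    unfolding set_lebesgue_integral_def
  proof (rule integral_nonneg_AE)
    show "AE s in lebesgue. 0 \<le> indicator {a<..} s *\<^sub>R ?u s"
      using nonneg by (rule AE_mp) (intro AE_I2, simp add: indicator_def lift_def H(5))
  qed
  with \<alpha> have "(1/4 - \<beta>\<^sup>2 - \<alpha>) * (LINT s:{a<..}|lebesgue. ?u s) \<le> 0"
    by (intro mult_nonpos_nonneg) auto
  with * show ?thesis by linarith
qed

section \<open>Estimates for the cutoff error\<close>

lemma integral_powr_T:
  assumes "a < n"
  shows "set_integrable lebesgue {a..n} (\<lambda>s. s powr (4 * \<beta> - 1))"
    and "(LINT s:{a..n}|lebesgue. s powr (4 * \<beta> - 1)) = \<beta> * (T n)\<^sup>2 + a powr (2 * \<beta>) * T n"
proof -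
  \<comment> \<open>The integrand is s^(2\<beta>) T'(s), and by \<open>powr_T\<close> the first
    factor is affine in T; this gives an antiderivative quadratic in T.\<close>
  have d: "((\<lambda>s. \<beta> * (T s)\<^sup>2 + a powr (2 * \<beta>) * T s) has_vector_derivative s powr (4 * \<beta> - 1))
      (at s within {a..n})" if "s \<in> {a..n}" for s
  proof -
    have "s > 0" using that a_pos by auto
    have "((\<lambda>s. \<beta> * (T s)\<^sup>2 + a powr (2 * \<beta>) * T s) has_real_derivative
        (2 * \<beta> * T s + a powr (2 * \<beta>)) * s powr (2 * \<beta> - 1)) (at s)"
      using has_deriv_T[OF \<open>s > 0\<close>] by (auto intro!: derivative_eq_intros simp: algebra_simps)
    also have "(2 * \<beta> * T s + a powr (2 * \<beta>)) * s powr (2 * \<beta> - 1) = s powr (4 * \<beta> - 1)"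
      by (simp flip: powr_T[OF \<open>s > 0\<close>] powr_add)
    finally show ?thesis
      by (simp add: has_real_derivative_iff_has_vector_derivative has_vector_derivative_at_within)
  qed
  have "continuous_on {a..n} (\<lambda>s. s powr (4 * \<beta> - 1))"
    using a_pos by (intro continuous_intros) auto
  then show i: "set_integrable lebesgue {a..n} (\<lambda>s. s powr (4 * \<beta> - 1))"
    by (rule absolutely_integrable_continuous_real)
  show "(LINT s:{a..n}|lebesgue. s powr (4 * \<beta> - 1)) = \<beta> * (T n)\<^sup>2 + a powr (2 * \<beta>) * T n"
    using set_lebesgue_integral_eq_integral(2)[OF i] assms
      integral_unique[OF fundamental_theorem_of_calculus[OF _ d]] by (simp add: T_a)
qed

text \<open>Dominated convergence with majorant |f|: since T(n) tends to infinity, each fixed s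
  eventually leaves the region T s \<ge> T(n)/2.\<close>

lemma tail_tendsto_0:
  fixes f :: "real \<Rightarrow> real"
  assumes "set_integrable lebesgue {a<..} f"
  shows "(\<lambda>n. LINT s:{a<..}|lebesgue. (if T s \<ge> T (real n) / 2 then f s else 0)) \<longlonglongrightarrow> 0"
    "set_integrable lebesgue {a<..} (\<lambda>s. if T s \<ge> T (real n) / 2 then f s else 0)"
proof -
  have Tm: "{s\<in>{a<..}. T s \<ge> c} \<in> sets lebesgue" for c
  proof -
    have "continuous_on {a<..} T" by (rule continuous_on_T) simp
    then have "closedin (top_of_set {a<..}) ({a<..} \<inter> T -` {c..})"
      by (rule continuous_closedin_preimage) simp
    moreover have "{s\<in>{a<..}. T s \<ge> c} = {a<..} \<inter> T -` {c..}" by auto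
    ultimately show ?thesis
      using lebesgue_closedin[of "{a<..}" "{a<..} \<inter> T -` {c..}"] by simp
  qed
  have eq: "indicator {a<..} s *\<^sub>R (if T s \<ge> c then f s else 0)
      = indicator {s\<in>{a<..}. T s \<ge> c} s *\<^sub>R (indicator {a<..} s *\<^sub>R f s)" for s c
    by (auto simp: indicator_def)
  have f: "integrable lebesgue (\<lambda>s. indicator {a<..} s *\<^sub>R f s)"
    using assms by (simp add: set_integrable_def)
  show "set_integrable lebesgue {a<..} (\<lambda>s. if T s \<ge> T (real n) / 2 then f s else 0)"
    unfolding set_integrable_def eq by (rule integrable_mult_indicator[OF Tm f])
  have "(\<lambda>n. LINT s|lebesgue. indicator {s\<in>{a<..}. T s \<ge> T (real n) / 2} s *\<^sub>R
      (indicator {a<..} s *\<^sub>R f s)) \<longlonglongrightarrow> (LINT s|(lebesgue :: real measure). 0 :: real)"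
  proof (rule integral_dominated_convergence[where f = "\<lambda>_. 0" and w = "\<lambda>s. norm (indicator {a<..} s *\<^sub>R f s)"])
    have lim: "filterlim (\<lambda>n. T (real n)) at_top sequentially"
      using T_at_top filterlim_real_sequentially by (rule filterlim_compose)
    show "AE s in lebesgue. (\<lambda>n. indicator {s\<in>{a<..}. T s \<ge> T (real n) / 2} s *\<^sub>R
        (indicator {a<..} s *\<^sub>R f s)) \<longlonglongrightarrow> 0"
    proof (rule AE_I2)
      fix s
      have "eventually (\<lambda>n. T (real n) > 2 * T s) sequentially"
        using lim by (simp add: filterlim_at_top_dense)
      then have "eventually (\<lambda>n. indicator {s\<in>{a<..}. T s \<ge> T (real n) / 2} s *\<^sub>R
          (indicator {a<..} s *\<^sub>R f s) = 0) sequentially"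
        by (rule eventually_mono) (simp add: indicator_def)
      then show "(\<lambda>n. indicator {s\<in>{a<..}. T s \<ge> T (real n) / 2} s *\<^sub>R
          (indicator {a<..} s *\<^sub>R f s)) \<longlonglongrightarrow> 0"
        by (rule tendsto_eventually)
    qed
    show "integrable lebesgue (\<lambda>s. norm (indicator {a<..} s *\<^sub>R f s))"
      by (rule integrable_norm[OF f])
    show "(\<lambda>s. indicator {s\<in>{a<..}. T s \<ge> T (real n) / 2} s *\<^sub>R (indicator {a<..} s *\<^sub>R f s))
        \<in> borel_measurable lebesgue" for n
      by (rule borel_measurable_integrable[OF integrable_mult_indicator[OF Tm f]])
    show "AE s in lebesgue. norm (indicator {s\<in>{a<..}. T s \<ge> T (real n) / 2} s *\<^sub>R
        (indicator {a<..} s *\<^sub>R f s)) \<le> norm (indicator {a<..} s *\<^sub>R f s)" for n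
      by (rule AE_I2) (simp add: indicator_def)
  qed simp
  then show "(\<lambda>n. LINT s:{a<..}|lebesgue. (if T s \<ge> T (real n) / 2 then f s else 0)) \<longlonglongrightarrow> 0"
    unfolding set_lebesgue_integral_def eq by simp
qed


text \<open>Here x stands for \<psi>(s), and L = T n / 2 places the cutoff region at T n / 2 \<le> T
  s \<le> T n. On [b, c] the cutoff is still on its plateau; the error on the cutoff region is split
  into the last two terms.\<close>

lemma pointwise_bound:
  assumes D: "\<And>t. \<bar>deriv cutoff t\<bar> \<le> D" "\<And>t. \<bar>deriv (deriv cutoff) t\<bar> \<le> D"
    and "a < b" "b < c" "c < n" "T c \<le> T n / 2" "K > 0" "s > a" "x \<ge> 0"
  shows "cutoff 1 * (indicator {b..c} s * (x * (s powr (3 * \<beta> - 3/2) * flat (-3) (T s - T b))))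
    \<le> x * lift (3 * \<beta> - 3/2) (deriv (deriv (profile (T b) (T n / 2)))) s
      + K * (if T s \<ge> T n / 2 then s powr (-2 * (1 - \<beta>)) * \<bar>x\<bar>\<^sup>2 else 0)
      + 16 * D\<^sup>2 / (K * (T n)\<^sup>2) * (indicator {a..n} s * s powr (4 * \<beta> - 1))"
proof -
  define L where "L = T n / 2"
  have "s > 0" and "D \<ge> 0" using assms(8) a_pos D(1)[of 0] by linarith+
  have "0 < T b" "T b < T c" using assms T_less[of a b] T_less[of b c] a_pos by (auto simp: T_a)
  then have "L > 0" using assms by (simp add: L_def)
  let ?e = "3 * \<beta> - 3/2" and ?P = "deriv (deriv (profile (T b) L))"
  define w where "w = x * s powr ?e"
  have "w \<ge> 0" using assms by (simp add: w_def)
  have lift: "x * lift ?e ?P s = w * ?P (T s)"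
    using \<open>s > a\<close> by (simp add: lift_def w_def)
  have "w * (flat (-3) (T s - T b) * cutoff (T s / L) - (if T s \<in> {L..2 * L} then 4 * D / L else 0))
      \<le> w * ?P (T s)"
    using \<open>w \<ge> 0\<close> \<open>L > 0\<close> \<open>0 < T b\<close> by (intro mult_left_mono deriv2_profile_ge D) auto
  moreover have "cutoff 1 * (indicator {b..c} s * (w * flat (-3) (T s - T b)))
      \<le> w * (flat (-3) (T s - T b) * cutoff (T s / L))"
  proof (cases "s \<in> {b..c}")
    case True
    then have "T s \<le> T c" using T_less[of s c] \<open>s > 0\<close> by (cases "s = c") auto
    then have "T s / L \<le> 1" using \<open>L > 0\<close> assms by (simp add: L_def)
    with True show ?thesis by (simp add: cutoff_left[of "T s / L"])
  qed (use \<open>w \<ge> 0\<close> flat_nonneg cutoff_nonneg in simp)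
  moreover have "w * (if T s \<in> {L..2 * L} then 4 * D / L else 0)
      \<le> K * (if T s \<ge> L then s powr (-2 * (1 - \<beta>)) * \<bar>x\<bar>\<^sup>2 else 0)
        + 4 * D\<^sup>2 / (K * L\<^sup>2) * (indicator {a..n} s * s powr (4 * \<beta> - 1))"
  proof (cases "T s \<in> {L..2 * L}")
    case True
    then have "s \<le> n" using T_less[of n s] assms a_pos by (force simp: L_def not_less)
    \<comment> \<open>The exponent 3\<beta> - 3/2 splits as (\<beta> - 1) + (2\<beta> - 1/2): X^2 is
      the density in the assumed weighted integral, and Y^2 is the weight integrated in
      \<open>integral_powr_T\<close>.\<close>
    define X where "X = s powr (\<beta> - 1) * x"
    define Y where "Y = s powr (2 * \<beta> - 1/2)"
    have "w = X * Y"
      by (simp add: w_def X_def Y_def algebra_simps flip: powr_add)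
    moreover have "s powr (-2 * (1 - \<beta>)) * \<bar>x\<bar>\<^sup>2 = X\<^sup>2" "s powr (4 * \<beta> - 1) = Y\<^sup>2"
      by (simp_all add: X_def Y_def power_mult_distrib power2_eq_square algebra_simps flip: powr_add)
    moreover have "X * Y * (4 * D / L) \<le> K * X\<^sup>2 + 4 * D\<^sup>2 / (K * L\<^sup>2) * Y\<^sup>2"
    proof -
      \<comment> \<open>Weighted AM-GM, with coefficients chosen so that the cross term is exactly
        the cutoff error 4D/L times X Y.\<close>
      have "0 \<le> (K * X - 2 * D * Y / L)\<^sup>2 / K" using \<open>K > 0\<close> by simp
      also have "\<dots> = K * X\<^sup>2 + 4 * D\<^sup>2 / (K * L\<^sup>2) * Y\<^sup>2 - X * Y * (4 * D / L)"
        using \<open>K > 0\<close> \<open>L > 0\<close> by (simp add: field_simps power2_eq_square)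
      finally show ?thesis by simp
    qed
    ultimately show ?thesis using True \<open>s \<le> n\<close> \<open>s > a\<close> by simp
  next
    case False
    then have "w * (if T s \<in> {L..2 * L} then 4 * D / L else 0) = 0"
      unfolding if_not_P[OF False] by simp
    also have "\<dots> \<le> K * (if T s \<ge> L then s powr (-2 * (1 - \<beta>)) * \<bar>x\<bar>\<^sup>2 else 0)
        + 4 * D\<^sup>2 / (K * L\<^sup>2) * (indicator {a..n} s * s powr (4 * \<beta> - 1))"
      using \<open>K > 0\<close> by (intro add_nonneg_nonneg mult_nonneg_nonneg) auto
    finally show ?thesis .
  qed
  ultimately have "cutoff 1 * (indicator {b..c} s * (w * flat (-3) (T s - T b)))
      \<le> w * ?P (T s) + K * (if T s \<ge> L then s powr (-2 * (1 - \<beta>)) * \<bar>x\<bar>\<^sup>2 else 0)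
        + 4 * D\<^sup>2 / (K * L\<^sup>2) * (indicator {a..n} s * s powr (4 * \<beta> - 1))"
    unfolding right_diff_distrib[of w] by linarith
  moreover have "4 * D\<^sup>2 / (K * L\<^sup>2) = 16 * D\<^sup>2 / (K * (T n)\<^sup>2)"
    by (simp add: L_def power_divide)
  moreover have "x * (s powr ?e * flat (-3) (T s - T b)) = w * flat (-3) (T s - T b)"
    by (simp add: w_def)
  ultimately show ?thesis
    by (simp only: L_def[symmetric] lift)
qed

text \<open>Integrating \<open>pointwise_bound\<close>, the profile term is non-positive by
  \<open>weak_inequality\<close>. The integral of s^(4\<beta>-1) is at most quadratic in T n, which
  the denominator absorbs; T n \<ge> 1 makes the resulting constant independent of n.\<close>

lemma local_integral_bound:
  assumes sol: "distributional_solution a \<alpha> \<psi>"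
    and nonneg: "AE s\<in>{a<..} in lebesgue. \<psi> s \<ge> 0"
    and \<alpha>: "\<alpha> \<ge> 1/4 - \<beta>\<^sup>2"
    and X2: "set_integrable lebesgue {a<..} (\<lambda>s. s powr (-2 * (1 - \<beta>)) * \<bar>\<psi> s\<bar>\<^sup>2)"
    and D: "\<And>t. \<bar>deriv cutoff t\<bar> \<le> D" "\<And>t. \<bar>deriv (deriv cutoff) t\<bar> \<le> D"
    and bcn: "a < b" "b < c" "c < real n" "T c \<le> T (real n) / 2" "1 \<le> T (real n)" and "K > 0"
  shows "cutoff 1 * (LINT s:{b..c}|lebesgue. \<psi> s * (s powr (3 * \<beta> - 3/2) * flat (-3) (T s - T b)))
    \<le> K * (LINT s:{a<..}|lebesgue.
          (if T s \<ge> T (real n) / 2 then s powr (-2 * (1 - \<beta>)) * \<bar>\<psi> s\<bar>\<^sup>2 else 0))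
      + 16 * D\<^sup>2 * (\<beta> + a powr (2 * \<beta>)) / K"
proof -
  have L1: "\<psi> \<in> L1_loc {a<..}" using sol by (simp add: distributional_solution_def)
  let ?L = "T n / 2" and ?e = "3 * \<beta> - 3/2"
  let ?H = "profile (T b) ?L"
  let ?f = "\<lambda>s. \<psi> s * (s powr ?e * flat (-3) (T s - T b))"
    and ?g = "\<lambda>s. \<psi> s * lift ?e (deriv (deriv ?H)) s"
    and ?h = "\<lambda>s. if T s \<ge> T (real n) / 2 then s powr (-2 * (1 - \<beta>)) * \<bar>\<psi> s\<bar>\<^sup>2 else 0"
    and ?y = "\<lambda>s. s powr (4 * \<beta> - 1)"
  let ?C = "16 * D\<^sup>2 / (K * (T n)\<^sup>2)"
  have out: "?H t = 0" if "t \<notin> {T b..T n}" for t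
    using that bcn by (intro profile_outside) auto
  have out': "deriv ?H t = 0" if "t \<notin> {T b..T n}" for t
    using out that by (rule deriv_eq_0_outside)
  have out'': "deriv (deriv ?H) t = 0" if "t \<notin> {T b..T n}" for t
    using out' that by (rule deriv_eq_0_outside)
  have "b < real n" using bcn by linarith
  have g: "set_integrable lebesgue {a<..} ?g"
    by (rule integrable_lift[OF L1 smooth_deriv[OF smooth_deriv[OF smooth_profile]] out''
          \<open>a < b\<close> \<open>b < n\<close>])
  have g_le: "(LINT s:{a<..}|lebesgue. ?g s) \<le> 0"
    by (rule weak_inequality[OF sol nonneg \<alpha> smooth_profile out \<open>a < b\<close> \<open>b < n\<close> profile_nonneg])
  have "smooth (\<lambda>t. flat (-3) (1 * t + (- T b)))"
    by (rule smooth_compose[OF smooth_flat smooth_affine])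
  from continuous_on_weight[OF this, of "{b..c}" ?e]
  have "continuous_on {b..c} (\<lambda>s. s powr ?e * flat (-3) (T s - T b))"
    using \<open>a < b\<close> by (simp add: subset_eq)
  then have f: "set_integrable lebesgue {b..c} ?f"
    using \<open>a < b\<close> by (intro integrable_mult_continuous[OF L1]) auto
  have h: "set_integrable lebesgue {a<..} ?h" by (rule tail_tendsto_0(2)[OF X2])
  have "a < n" using bcn by linarith
  note y = integral_powr_T[OF this]
  note int = f[unfolded set_integrable_def] g[unfolded set_integrable_def]
    h[unfolded set_integrable_def] y(1)[unfolded set_integrable_def]
  have "(LINT s|lebesgue. cutoff 1 * (indicator {b..c} s *\<^sub>R ?f s))
      \<le> (LINT s|lebesgue. indicator {a<..} s *\<^sub>R ?g s + K * (indicator {a<..} s *\<^sub>R ?h s)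
          + ?C * (indicator {a..n} s *\<^sub>R ?y s))"
  proof (rule integral_mono_AE)
    show "AE s in lebesgue. cutoff 1 * (indicator {b..c} s *\<^sub>R ?f s)
      \<le> indicator {a<..} s *\<^sub>R ?g s + K * (indicator {a<..} s *\<^sub>R ?h s)
          + ?C * (indicator {a..n} s *\<^sub>R ?y s)"
      using nonneg
    proof (rule AE_mp, intro AE_I2 impI)
      fix s assume *: "s \<in> {a<..} \<longrightarrow> 0 \<le> \<psi> s"
      show "cutoff 1 * (indicator {b..c} s *\<^sub>R ?f s)
        \<le> indicator {a<..} s *\<^sub>R ?g s + K * (indicator {a<..} s *\<^sub>R ?h s)
          + ?C * (indicator {a..n} s *\<^sub>R ?y s)"
      proof (cases "s > a")
        case True
        with * pointwise_bound[OF D bcn(1-4) \<open>K > 0\<close> True, of "\<psi> s"] show ?thesis by simp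
      next
        \<comment> \<open>For s \<le> a every indicator vanishes except possibly that of [a, n] at s
          = a, which adds a non-negative term on the right.\<close>
        case False
        with \<open>a < b\<close> \<open>K > 0\<close> show ?thesis by (simp add: indicator_def)
      qed
    qed
  qed (intro Bochner_Integration.integrable_add integrable_mult_right int)+
  also have "\<dots> = (LINT s:{a<..}|lebesgue. ?g s) + K * (LINT s:{a<..}|lebesgue. ?h s)
      + ?C * (LINT s:{a..n}|lebesgue. ?y s)"
    unfolding set_lebesgue_integral_def
    by (simp only: Bochner_Integration.integral_add Bochner_Integration.integrable_add
        integrable_mult_right integral_mult_right_zero int)
  also have "?C * (LINT s:{a..n}|lebesgue. ?y s)
      = 16 * D\<^sup>2 / K * (\<beta> + a powr (2 * \<beta>) / T n)"
    unfolding y(2) using bcn(5) \<open>K > 0\<close> by (simp add: field_simps power2_eq_square)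
  also have "\<dots> \<le> 16 * D\<^sup>2 / K * (\<beta> + a powr (2 * \<beta>))"
  proof -
    have "a powr (2 * \<beta>) / T n \<le> a powr (2 * \<beta>) / 1"
      using bcn(5) by (intro divide_left_mono) auto
    then show ?thesis using \<open>K > 0\<close> by (intro mult_left_mono) auto
  qed
  finally show ?thesis using g_le by (simp add: set_lebesgue_integral_def)
qed

text \<open>The weighted integral J of \<psi> over [b, c] is non-negative, and the previous bound
  forces J \<le> 0. Its weight is positive for s > b but vanishes at s = b, hence the half-open
  interval.\<close>

lemma AE_eq_0_local:
  assumes sol: "distributional_solution a \<alpha> \<psi>"
    and nonneg: "AE s\<in>{a<..} in lebesgue. \<psi> s \<ge> 0"
    and \<alpha>: "\<alpha> \<ge> 1/4 - \<beta>\<^sup>2"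
    and X2: "set_integrable lebesgue {a<..} (\<lambda>s. s powr (-2 * (1 - \<beta>)) * \<bar>\<psi> s\<bar>\<^sup>2)"
    and bc: "a < b" "b < c"
  shows "AE s\<in>{b<..c} in lebesgue. \<psi> s = 0"
proof -
  have L1: "\<psi> \<in> L1_loc {a<..}" using sol by (simp add: distributional_solution_def)
  obtain D where "D > 0" and D: "\<And>t. \<bar>deriv cutoff t\<bar> \<le> D" "\<And>t. \<bar>deriv (deriv cutoff) t\<bar> \<le> D"
    using cutoff_derivs_bounded by blast
  let ?k = "\<lambda>s. s powr (3 * \<beta> - 3/2) * flat (-3) (T s - T b)"
  define J where "J = (LINT s:{b..c}|lebesgue. \<psi> s * ?k s)"
  define C where "C = 16 * D\<^sup>2 * (\<beta> + a powr (2 * \<beta>))"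
  have "C > 0" using \<open>D > 0\<close> beta_nonneg a_pos by (auto simp: C_def intro!: mult_pos_pos add_nonneg_pos)
  have *: "cutoff 1 * J \<le> C / K" if "K > 0" for K
  proof -
    let ?tail = "\<lambda>n. LINT s:{a<..}|lebesgue.
      (if T s \<ge> T (real n) / 2 then s powr (-2 * (1 - \<beta>)) * \<bar>\<psi> s\<bar>\<^sup>2 else 0)"
    have lim: "filterlim (\<lambda>n. T (real n)) at_top sequentially"
      using T_at_top filterlim_real_sequentially by (rule filterlim_compose)
    have "eventually (\<lambda>n. T (real n) \<ge> 2 * T c) sequentially"
      "eventually (\<lambda>n. T (real n) \<ge> 1) sequentially"
      using lim unfolding filterlim_at_top by blast+
    moreover have "eventually (\<lambda>n. real n > c) sequentially"
      using filterlim_real_sequentially unfolding filterlim_at_top_dense by blast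
    ultimately have "eventually (\<lambda>n. cutoff 1 * J \<le> K * ?tail n + C / K) sequentially"
    proof eventually_elim
      case (elim n)
      then show ?case
        unfolding J_def C_def
        by (intro local_integral_bound[OF sol nonneg \<alpha> X2 D bc]) (use \<open>K > 0\<close> in auto)
    qed
    \<comment> \<open>K is fixed while n grows, so the factor K in front of the tail is
      harmless.\<close>
    moreover have "(\<lambda>n. K * ?tail n + C / K) \<longlonglongrightarrow> K * 0 + C / K"
      by (intro tendsto_intros tail_tendsto_0(1)[OF X2])
    ultimately show ?thesis
      using tendsto_lowerbound[of _ "K * 0 + C / K" sequentially "cutoff 1 * J"] by simp
  qed
  have "J \<le> 0"
  proof (rule ccontr)
    assume "\<not> J \<le> 0"
    then have "cutoff 1 * J > 0" using cutoff_1_pos by simp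
    \<comment> \<open>With this K the bound C / K is half of \<open>cutoff 1 * J\<close>,
      contradicting positivity.\<close>
    with *[of "2 * C / (cutoff 1 * J)"] \<open>C > 0\<close> show False by (simp add: mult.commute)
  qed
  have "smooth (\<lambda>t. flat (-3) (1 * t + (- T b)))"
    by (rule smooth_compose[OF smooth_flat smooth_affine])
  from continuous_on_weight[OF this, of "{b..c}" "3 * \<beta> - 3/2"]
  have "continuous_on {b..c} ?k"
    using \<open>a < b\<close> by (simp add: subset_eq)
  then have "set_integrable lebesgue {b..c} (\<lambda>s. \<psi> s * ?k s)"
    using \<open>a < b\<close> by (intro integrable_mult_continuous[OF L1]) auto
  then have int: "integrable lebesgue (\<lambda>s. indicator {b..c} s *\<^sub>R (\<psi> s * ?k s))"
    by (simp add: set_integrable_def)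
  have nn: "AE s in lebesgue. 0 \<le> indicator {b..c} s *\<^sub>R (\<psi> s * ?k s)"
    using nonneg by (rule AE_mp) (intro AE_I2, use \<open>a < b\<close> in \<open>simp add: indicator_def flat_nonneg\<close>)
  have "J \<ge> 0"
    unfolding J_def set_lebesgue_integral_def by (rule integral_nonneg_AE[OF nn])
  with \<open>J \<le> 0\<close> have "(LINT s|lebesgue. indicator {b..c} s *\<^sub>R (\<psi> s * ?k s)) = 0"
    by (simp add: J_def set_lebesgue_integral_def)
  then have "AE s in lebesgue. indicator {b..c} s *\<^sub>R (\<psi> s * ?k s) = 0"
    using integral_nonneg_eq_0_iff_AE[OF int nn] by blast
  then show ?thesis
  proof (rule AE_mp, intro AE_I2 impI)
    fix s assume 0: "indicator {b..c} s *\<^sub>R (\<psi> s * ?k s) = 0" and s: "s \<in> {b<..c}"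
    have "T s > T b" using s \<open>a < b\<close> a_pos by (intro T_less) auto
    then have "flat (-3) (T s - T b) > 0" by (simp add: flat_pos)
    moreover have "s > 0" using s \<open>a < b\<close> a_pos by simp
    ultimately show "\<psi> s = 0" using 0 s by simp
  qed
qed

end

section \<open>Conclusion on the whole half-line\<close>

theorem theorem1p3:
  fixes a \<alpha> :: real and \<psi> :: "real \<Rightarrow> real"
  assumes "a > 0"
    and "AE s\<in>{a<..} in lebesgue. \<psi> s \<ge> 0"
    and "distributional_solution a \<alpha> \<psi>"
    and "\<exists>\<gamma>\<le>1. \<psi> \<in> weighted_L2 a \<gamma> \<and> \<alpha> \<ge> 1/4 - (1 - \<gamma>)\<^sup>2"
  shows "AE s\<in>{a<..} in lebesgue. \<psi> s = 0"
proof -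
  obtain \<gamma> where \<gamma>: "\<gamma> \<le> 1" "\<psi> \<in> weighted_L2 a \<gamma>" "\<alpha> \<ge> 1/4 - (1 - \<gamma>)\<^sup>2"
    using assms(4) by blast
  interpret euler a "1 - \<gamma>"
    by unfold_locales (use assms(1) \<gamma>(1) in auto)
  have "(\<lambda>s. indicator {a<..} s *\<^sub>R \<psi> s) \<in> borel_measurable lebesgue"
    and fin: "(\<integral>\<^sup>+s\<in>{a<..}. ennreal (s powr (-2 * \<gamma>) * \<bar>\<psi> s\<bar>\<^sup>2) \<partial>lebesgue) < \<infinity>"
    using \<gamma>(2) by (auto simp: weighted_L2_def set_borel_measurable_def)
  moreover have "(\<lambda>s::real. s powr (-2 * \<gamma>)) \<in> borel_measurable lebesgue"
    by (rule measurable_completion) measurable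
  \<comment> \<open>Measurability is given for the truncation of \<psi> to the half-line, so the
    indicator sits inside the square first and is then moved out.\<close>
  ultimately have "(\<lambda>s. s powr (-2 * \<gamma>) * \<bar>indicator {a<..} s *\<^sub>R \<psi> s\<bar>\<^sup>2)
      \<in> borel_measurable lebesgue"
    by (intro borel_measurable_times borel_measurable_power borel_measurable_abs) auto
  also have "(\<lambda>s. s powr (-2 * \<gamma>) * \<bar>indicator {a<..} s *\<^sub>R \<psi> s\<bar>\<^sup>2)
      = (\<lambda>s. indicator {a<..} s *\<^sub>R (s powr (-2 * \<gamma>) * \<bar>\<psi> s\<bar>\<^sup>2))"
    by (auto simp: indicator_def)
  finally have "integrable lebesgue (\<lambda>s. indicator {a<..} s *\<^sub>R (s powr (-2 * \<gamma>) * \<bar>\<psi> s\<bar>\<^sup>2))"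
  proof (rule integrableI_nonneg)
    have "(\<integral>\<^sup>+s. ennreal (indicator {a<..} s *\<^sub>R (s powr (-2 * \<gamma>) * \<bar>\<psi> s\<bar>\<^sup>2)) \<partial>lebesgue)
        = (\<integral>\<^sup>+s\<in>{a<..}. ennreal (s powr (-2 * \<gamma>) * \<bar>\<psi> s\<bar>\<^sup>2) \<partial>lebesgue)"
      by (intro nn_integral_cong) (simp add: indicator_def)
    with fin show "(\<integral>\<^sup>+s. ennreal (indicator {a<..} s *\<^sub>R (s powr (-2 * \<gamma>) * \<bar>\<psi> s\<bar>\<^sup>2)) \<partial>lebesgue) < \<infinity>"
      by simp
  qed (auto intro!: AE_I2)
  then have X2: "set_integrable lebesgue {a<..} (\<lambda>s. s powr (-2 * (1 - (1 - \<gamma>))) * \<bar>\<psi> s\<bar>\<^sup>2)"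
    by (simp add: set_integrable_def)
  \<comment> \<open>These countably many intervals cover (a, \<infinity>), with left ends strictly
    above a as the local result requires; their exceptional null sets have a null union.\<close>
  have "AE s in lebesgue. s \<in> {a + 1 / real (Suc n)<..a + 1 / real (Suc n) + real (Suc n)} \<longrightarrow> \<psi> s = 0" for n
    by (rule AE_eq_0_local[OF assms(3,2) \<gamma>(3) X2]) auto
  then have "AE s in lebesgue. \<forall>n.
      s \<in> {a + 1 / real (Suc n)<..a + 1 / real (Suc n) + real (Suc n)} \<longrightarrow> \<psi> s = 0"
    by (intro iffD2[OF AE_all_countable] allI)
  then show ?thesis
  proof (rule AE_mp, intro AE_I2 impI)
    fix s assume *: "\<forall>n. s \<in> {a + 1 / real (Suc n)<..a + 1 / real (Suc n) + real (Suc n)} \<longrightarrow> \<psi> s = 0"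
      and s: "s \<in> {a<..}"
    obtain n1 where n1: "inverse (real (Suc n1)) < s - a"
      using reals_Archimedean[of "s - a"] s by auto
    obtain n2 :: nat where n2: "s - a < real n2"
      using reals_Archimedean2 by blast
    \<comment> \<open>The index n1 puts the left end below s, and n2 puts the right end beyond
      s.\<close>
    define n where "n = max n1 n2"
    have "1 / real (Suc n) \<le> inverse (real (Suc n1))"
      by (simp add: n_def field_simps)
    moreover have "real n2 \<le> real (Suc n)" by (simp add: n_def)
    moreover have "1 / real (Suc n) \<ge> 0" by simp
    ultimately have "a + 1 / real (Suc n) < s" "s \<le> a + 1 / real (Suc n) + real (Suc n)"
      using n1 n2 by linarith+
    with * show "\<psi> s = 0" by auto
  qed
qed

end
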